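(* Let $\tilde G$ be the graph with vertex set $\mathbb{Z}$ and edge set $E_0\cup\bigcup_{k\ge 0}E_{2^k}$ defined in the context. For an integer $i\ge 0$ let $\tilde x_{2^i}$ be the graph distance in $\tilde G$ from $0$ to $2^{2^i-1}$, and let $\tilde B_j(0)$ be the set of vertices at graph distance at most $j$ from $0$ in $\tilde G$. If $j=\tilde x_{2^i}$ for some integer $i\ge 0$, then $$j^2\le |\tilde B_j(0)|\le 8j^2.$$
   Context: $E_0=\{(i,i+1): i\in\mathbb{Z}\}$ and, for each integer $k\ge 1$, $E_k=\{(2^k(n-\tfrac12),\,2^k(n+\tfrac12)): n\in\mathbb{Z}\}$; edges are undirected. The graph $\tilde G$ has vertex set $\mathbb{Z}$ and edge set $E_0\cup\bigcup_{k\ge 0}E_{2^k}$, so only the layers $E_0,E_1,E_2,E_4,E_8,\dots$ are used. *)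

theory Defs
  imports "Graph_Theory.Graph_Theory"
begin

text \<open>
  The endpoints of the edges in layer \<open>k \<ge> 1\<close> are \<open>2^k (n - 1/2)\<close> and \<open>2^k (n + 1/2)\<close>; they are
  written here with the factor \<open>2^k\<close> multiplied out, so as to stay in the integers.
\<close>

definition layer :: "nat \<Rightarrow> (int \<times> int) set" where
  "layer k =
    (if k = 0 then {(n, n + 1) | n. True}
     else {(2 ^ k * n - 2 ^ (k - 1), 2 ^ k * n + 2 ^ (k - 1)) | n. True})"

lemma layer_half:
  assumes "k \<ge> 1"
  shows "(a, b) \<in> layer k \<longleftrightarrow>
    (\<exists>n::int. real_of_int a = 2 ^ k * (real_of_int n - 1 / 2) \<and>
              real_of_int b = 2 ^ k * (real_of_int n + 1 / 2))"
proof -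
  obtain m where m: "k = Suc m" using assms by (cases k) auto
  have l: "real_of_int a = 2 ^ k * (real_of_int n - 1 / 2) \<longleftrightarrow> a = 2 ^ k * n - 2 ^ (k - 1)" for n
  proof -
    have "2 ^ k * (real_of_int n - 1 / 2) = real_of_int (2 ^ k * n - 2 ^ (k - 1))"
      by (simp add: m algebra_simps)
    then show ?thesis by (simp only: of_int_eq_iff)
  qed
  have r: "real_of_int b = 2 ^ k * (real_of_int n + 1 / 2) \<longleftrightarrow> b = 2 ^ k * n + 2 ^ (k - 1)" for n
  proof -
    have "2 ^ k * (real_of_int n + 1 / 2) = real_of_int (2 ^ k * n + 2 ^ (k - 1))"
      by (simp add: m algebra_simps)
    then show ?thesis by (simp only: of_int_eq_iff)
  qed
  show ?thesis using assms unfolding l r by (auto simp: layer_def)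
qed

text \<open>An undirected graph is represented by the digraph containing both orientations of each edge.\<close>

definition G_tilde :: "int pair_pre_digraph" where
  "G_tilde =
    (let E = layer 0 \<union> (\<Union>k. layer (2 ^ k)) in \<lparr> pverts = UNIV, parcs = E \<union> E\<inverse> \<rparr>)"

lemma pverts_G_tilde [simp]: "pverts G_tilde = UNIV"
  by (simp add: G_tilde_def Let_def)

lemma sym_parcs_G_tilde: "sym (parcs G_tilde)"
  by (auto simp: G_tilde_def Let_def sym_def)

lemma irrefl_parcs_G_tilde: "irrefl (parcs G_tilde)"
  by (auto simp: G_tilde_def Let_def irrefl_def layer_def split: if_splits)

interpretation G_tilde: pair_wf_digraph G_tilde
  by unfold_locales auto

text \<open>With every arc of weight \<open>1\<close>, the cost of a walk is its number of edges.\<close>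

definition graph_dist :: "'a pair_pre_digraph \<Rightarrow> 'a \<Rightarrow> 'a \<Rightarrow> ereal" where
  "graph_dist G = wf_digraph.\<mu> (with_proj G) (\<lambda>_. 1)"

definition graph_ball :: "'a pair_pre_digraph \<Rightarrow> 'a \<Rightarrow> nat \<Rightarrow> 'a set" where
  "graph_ball G u r = {v \<in> pverts G. graph_dist G u v \<le> ereal (real r)}"

definition x_tilde :: "nat \<Rightarrow> ereal" where
  "x_tilde m = graph_dist G_tilde 0 (2 ^ (m - 1))"

text \<open>Distances in the graph are always (finite) natural numbers.\<close>

lemma reachable_G_tilde: "u \<rightarrow>\<^sup>*\<^bsub>G_tilde\<^esub> v"
proof -
  have step: "(n, n + 1) \<in> parcs G_tilde" "(n + 1, n) \<in> parcs G_tilde" for n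
    by (auto simp: G_tilde_def Let_def layer_def)
  have up: "u \<rightarrow>\<^sup>*\<^bsub>G_tilde\<^esub> (u + int n)" for u n
  proof (induction n)
    case (Suc n)
    then show ?case
      using step(1)[of "u + int n"] by (auto intro: G_tilde.reachable_adj_trans simp: ac_simps)
  qed simp
  have down: "(u + int n) \<rightarrow>\<^sup>*\<^bsub>G_tilde\<^esub> u" for u n
  proof (induction n)
    case (Suc n)
    then show ?case
      using step(2)[of "u + int n"] by (auto intro: G_tilde.adj_reachable_trans simp: ac_simps)
  qed simp
  show ?thesis
    using up[of u "nat (v - u)"] down[of v "nat (u - v)"] by (cases "u \<le> v") auto
qed

lemma graph_dist_G_tilde_nat: "\<exists>j::nat. graph_dist G_tilde u v = ereal (real j)"
proof -
  let ?P = "{p. pre_digraph.awalk (with_proj G_tilde) u p v}"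
  have "?P \<noteq> {}"
    using reachable_G_tilde[of u v] by (auto simp: G_tilde.reachable_awalk)
  then obtain p where p: "p \<in> ?P" "\<And>q. q \<in> ?P \<Longrightarrow> length p \<le> length q"
    using ex_has_least_nat[of "\<lambda>p. p \<in> ?P" _ length] by (metis all_not_in_conv)
  have cost: "G_tilde.awalk_cost (\<lambda>_. 1) q = real (length q)" for q
    by (induction q) simp_all
  have "graph_dist G_tilde u v = (INF q\<in>?P. ereal (real (length q)))"
    by (simp add: graph_dist_def G_tilde.\<mu>_def cost)
  also have "\<dots> = ereal (real (length p))"
    using p by (intro antisym INF_lower INF_greatest) auto
  finally show ?thesis by blast
qed

end

theory Submission
  imports Defs
begin

text \<open>
  Write \<open>h\<^sub>i = 2^(2^i - 1)\<close>, so that \<open>h\<^sub>i\<^sub>+\<^sub>1 = 2 h\<^sub>i\<^sup>2\<close>; layer \<open>2^i\<close> joins consecutive odd multiples of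
  \<open>h\<^sub>i\<close>. A walk from \<open>0\<close> to a nonzero multiple of \<open>h\<^sub>i\<^sub>+\<^sub>1\<close> in the layers below \<open>2^(i+1)\<close> is cut at its
  first and its last edge of layer \<open>2^i\<close>: the two outer pieces are walks in lower layers, and all edges
  in between have length at most \<open>2 h\<^sub>i\<close>. This yields the recursion \<open>x\<^sub>i\<^sub>+\<^sub>1 = 2 x\<^sub>i + h\<^sub>i - 1\<close> for the
  distance \<open>x\<^sub>i\<close> from \<open>0\<close> to \<open>h\<^sub>i\<close>, and shows that no nonzero multiple of \<open>h\<^sub>i\<close> is closer to \<open>0\<close>.

  Hence a walk of length at most \<open>x\<^sub>i\<^sub>+\<^sub>1\<close> from \<open>0\<close> has no edge of layer \<open>2^(i+1)\<close> or higher and stays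
  within \<open>2 h\<^sub>i x\<^sub>i\<^sub>+\<^sub>1\<close> of \<open>0\<close>, which gives the upper bound since \<open>h\<^sub>i \<le> x\<^sub>i\<^sub>+\<^sub>1\<close>. Conversely the ball of
  radius \<open>x\<^sub>i\<close> contains \<open>[-h\<^sub>i, h\<^sub>i]\<close>. This suffices for the lower bound except for \<open>i = 2\<close> and \<open>i = 3\<close>,
  where vertices beyond \<open>h\<^sub>i\<close> have to be counted as well.
\<close>

definition half :: "nat \<Rightarrow> int" where
  "half i = 2 ^ (2 ^ i - 1)"

text \<open>Adjacency in layer \<open>0\<close> and the layers \<open>2^k\<close> with \<open>k < i\<close>.\<close>

definition low :: "nat \<Rightarrow> int \<Rightarrow> int \<Rightarrow> bool" where
  "low i u v \<longleftrightarrow> \<bar>v - u\<bar> = 1 \<or> (\<exists>k<i. \<exists>n. odd n \<and> u = n * half k \<and> \<bar>v - u\<bar> = 2 * half k)"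

text \<open>The distance from \<open>0\<close> to \<open>half i\<close>; see \<open>x_tilde_two_power\<close>.\<close>

fun rad :: "nat \<Rightarrow> int" where
  "rad 0 = 1"
| "rad (Suc i) = 2 * rad i + half i - 1"

text \<open>The length of the longest edge that \<open>low i\<close> admits.\<close>

fun max_step :: "nat \<Rightarrow> int" where
  "max_step 0 = 1"
| "max_step (Suc i) = 2 * half i"

definition reach :: "nat \<Rightarrow> int \<Rightarrow> int \<Rightarrow> int \<Rightarrow> bool" where
  "reach i r u v \<longleftrightarrow> (\<exists>n. int n \<le> r \<and> (low i ^^ n) u v)"

section \<open>Growth and divisibility of \<open>half\<close>, \<open>max_step\<close> and
  \<open>rad\<close>\<close>

lemma half_0 [simp]: "half 0 = 1"
  by (simp add: half_def)

lemma half_Suc: "half (Suc i) = 2 * (half i)\<^sup>2"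
proof -
  obtain p where "(2::nat) ^ i = Suc p"
    by (metis not0_implies_Suc power_not_zero zero_neq_numeral)
  then show ?thesis
    by (simp add: half_def power_mult mult.commute)
qed

lemma half_pos [simp]: "0 < half i"
  by (simp add: half_def)

lemma half_neq_0 [simp]: "half i \<noteq> 0"
  by (simp add: half_def)

lemma half_nonneg [simp]: "0 \<le> half i"
  by (simp add: half_def)

lemma abs_double_half [simp]: "\<bar>2 * half i\<bar> = 2 * half i"
  by (simp add: half_def)

lemma half_ge_1: "1 \<le> half i"
  using half_pos[of i] by linarith

lemma half_dvd_mono: "i \<le> k \<Longrightarrow> half i dvd half k"
  by (auto simp: half_def intro!: le_imp_power_dvd diff_le_mono)

text \<open>The factor 2 matters: shifts by multiples of \<open>half i\<close> thereby preserve the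
  odd multiples of \<open>half k\<close>.\<close>

lemma double_half_dvd: "k < i \<Longrightarrow> 2 * half k dvd half i"
  using half_dvd_mono[of "Suc k" i] by (auto simp: half_Suc power2_eq_square dvd_def)

lemma half_ge_8:
  assumes "2 \<le> i"
  shows "8 \<le> half i"
proof -
  have "half 2 = 8" by (simp add: half_def)
  then show ?thesis
    using zdvd_imp_le[OF half_dvd_mono[OF assms]] by simp
qed

lemma max_step_pos: "0 < max_step i"
  by (cases i) auto

lemma max_step_mono: "k < i \<Longrightarrow> 2 * half k \<le> max_step i"
  by (cases i) (auto intro!: zdvd_imp_le half_dvd_mono)

lemma rad_pos: "1 \<le> rad i"
proof (induction i)
  case (Suc i)
  then show ?case using half_ge_1[of i] by simp
qed simp

lemma double_max_step_le_half:
  assumes "2 \<le> i"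
  shows "2 * max_step i \<le> half i"
proof -
  obtain k where k: "i = Suc k" "1 \<le> k"
    using assms by (cases i) auto
  have "2 \<le> half k"
    using zdvd_imp_le[OF half_dvd_mono[OF k(2)]] by (simp add: half_def)
  then have "2 * half k \<le> half k * half k"
    by (intro mult_right_mono) auto
  then show ?thesis by (simp add: k half_Suc power2_eq_square)
qed

text \<open>By induction \<open>rad (Suc i)\<close> is at most \<open>3 * half i\<close>, which the
  square of \<open>half i\<close> dominates; the cases with \<open>half i < 3\<close> are
  computed.\<close>

lemma rad_le_half: "rad i \<le> half i"
proof (induction i)
  case (Suc i)
  show ?case
  proof (cases "i \<le> 1")
    case True
    then have "i = 0 \<or> i = 1" by auto
    then show ?thesis by (auto simp: half_def)
  next
    case False
    then have "3 * half i \<le> half i * half i"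
      using half_ge_8[of i] by (intro mult_right_mono) auto
    moreover have "rad (Suc i) \<le> 3 * half i"
      using Suc by simp
    ultimately have "rad (Suc i) \<le> half i * half i"
      by (rule order_trans[rotated])
    moreover have "0 \<le> half i * half i" by simp
    ultimately show ?thesis
      unfolding half_Suc power2_eq_square by linarith
  qed
qed simp

lemma max_step_le_rad: "max_step i \<le> 2 * rad i"
proof (cases i)
  case (Suc k)
  then show ?thesis using rad_pos[of k] by simp
qed simp

section \<open>Symmetries and step lengths of walks in low layers\<close>

lemma low_mono: "low i u v \<Longrightarrow> i \<le> k \<Longrightarrow> low k u v"
  by (auto simp: low_def intro: less_le_trans)

lemma low_pow_mono: "(low i ^^ n) u v \<Longrightarrow> i \<le> k \<Longrightarrow> (low k ^^ n) u v"
  by (rule relpowp_mono[of "low i"]) (auto intro: low_mono)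

text \<open>The definition constrains only the start \<open>u = n * half k\<close>; the other end
  has the odd factor \<open>n + 2\<close> or \<open>n - 2\<close>.\<close>

lemma low_sym: "low i u v \<Longrightarrow> low i v u"
proof -
  have *: "\<exists>m. odd m \<and> v = m * half k" if "odd n" "u = n * half k" "\<bar>v - u\<bar> = 2 * half k" for n k
  proof -
    have "v - u = 2 * half k \<or> v - u = - (2 * half k)"
      using that(3) by linarith
    then have "v = (n + 2) * half k \<or> v = (n - 2) * half k"
      using that(2) unfolding distrib_right left_diff_distrib by linarith
    then show ?thesis using that(1) by (metis even_add even_diff even_numeral)
  qed
  show "low i u v \<Longrightarrow> low i v u"
    using * unfolding low_def by (metis abs_minus_commute)
qed

lemma low_pow_sym: "(low i ^^ n) u v \<Longrightarrow> (low i ^^ n) v u"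
proof (induction n arbitrary: v)
  case (Suc n)
  then show ?case by (metis low_sym relpowp_Suc_E relpowp_Suc_I2)
qed simp

lemma low_translate:
  assumes "half i dvd t" "low i u v"
  shows "low i (u + t) (v + t)"
proof -
  have "\<exists>m. odd m \<and> u + t = m * half k" if k: "k < i" and n: "odd n" "u = n * half k" for k n
  proof -
    obtain s where "t = 2 * half k * s"
      using dvd_trans[OF double_half_dvd[OF k] assms(1)] by (elim dvdE)
    then have "u + t = (n + 2 * s) * half k"
      using n by (simp add: algebra_simps)
    then show ?thesis using n(1) by (metis dvd_triv_left even_add)
  qed
  then show ?thesis
    using assms(2) by (fastforce simp: low_def)
qed

lemma low_pow_translate:
  "half i dvd t \<Longrightarrow> (low i ^^ n) u v \<Longrightarrow> (low i ^^ n) (u + t) (v + t)"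
proof (induction n arbitrary: v)
  case (Suc n)
  then show ?case by (metis low_translate relpowp_Suc_E relpowp_Suc_I)
qed simp

lemma low_uminus: "low i u v \<Longrightarrow> low i (- u) (- v)"
  unfolding low_def by (metis abs_minus_commute even_minus minus_diff_minus minus_mult_left abs_minus_cancel)

lemma low_pow_uminus: "(low i ^^ n) u v \<Longrightarrow> (low i ^^ n) (- u) (- v)"
proof (induction n arbitrary: v)
  case (Suc n)
  then show ?case by (metis low_uminus relpowp_Suc_E relpowp_Suc_I)
qed simp

lemma low_step_le: "low i u v \<Longrightarrow> \<bar>v - u\<bar> \<le> max_step i"
  using max_step_pos[of i] max_step_mono[of _ i] by (fastforce simp: low_def)

lemma low_pow_le: "(low i ^^ n) u v \<Longrightarrow> \<bar>v - u\<bar> \<le> int n * max_step i"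
proof (induction n arbitrary: v)
  case (Suc n)
  then obtain w where "(low i ^^ n) u w" "low i w v"
    by (auto elim: relpowp_Suc_E)
  then have "\<bar>w - u\<bar> \<le> int n * max_step i" "\<bar>v - w\<bar> \<le> max_step i"
    using Suc.IH low_step_le by auto
  then show ?case by (auto simp: algebra_simps)
qed simp

text \<open>A multiple of \<open>half i\<close> is an even multiple of every \<open>half k\<close>
  with \<open>k < i\<close>, so no long edge of \<open>low i\<close> starts there.\<close>

lemma low_step_of_half_dvd:
  assumes "half i dvd u" "low i u v"
  shows "\<bar>v - u\<bar> = 1"
proof (rule ccontr)
  assume "\<bar>v - u\<bar> \<noteq> 1"
  then obtain k n where k: "k < i" "odd n" "u = n * half k"
    using assms(2) by (auto simp: low_def)
  then have "2 * half k dvd n * half k"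
    using dvd_trans[OF double_half_dvd assms(1)] by blast
  then show False
    using k(2) half_pos[of k] by simp
qed

text \<open>
  The first step from \<open>0\<close> has length \<open>1\<close>. The resulting gain over \<open>low_pow_le\<close> is needed for the
  case \<open>i = 1\<close> of \<open>low_pow_half_ge\<close>.
\<close>

lemma low_pow_0_le:
  assumes "(low i ^^ n) 0 v" "v \<noteq> 0"
  shows "\<bar>v\<bar> \<le> 1 + (int n - 1) * max_step i"
proof -
  obtain m where m: "n = Suc m"
    using assms by (cases n) auto
  then obtain w where w: "low i 0 w" "(low i ^^ m) w v"
    using assms(1) by (metis relpowp_Suc_D2)
  then have "\<bar>w\<bar> = 1"
    using low_step_of_half_dvd[of i 0 w] by simp
  then show ?thesis
    using low_pow_le[OF w(2)] m by simp
qed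

section \<open>Lower bound for the distance to multiples of \<open>half i\<close>\<close>

lemma low_Suc_cases:
  assumes "low (Suc i) u v" "\<not> low i u v"
  obtains m n where "odd m" "u = m * half i" "odd n" "v = n * half i"
proof -
  have *: "\<exists>m. odd m \<and> u = m * half i" if "low (Suc i) u v" "\<not> low i u v" for u v
    using that unfolding low_def by (metis less_antisym)
  show thesis
    using *[OF assms] *[of v u] assms low_sym that by metis
qed

text \<open>Induction on the last step: a step of \<open>low i\<close> extends the last piece, while
  a new edge of layer \<open>2^i\<close> absorbs that piece into the middle one.\<close>

lemma low_pow_Suc_decompose:
  assumes "(low (Suc i) ^^ n) u v" "\<not> (low i ^^ n) u v"
  shows "\<exists>a b c p q. n = a + b + c \<and> odd p \<and> odd q \<and> (low i ^^ a) u (p * half i)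
    \<and> (low (Suc i) ^^ b) (p * half i) (q * half i) \<and> (low i ^^ c) (q * half i) v"
  using assms
proof (induction n arbitrary: v)
  case (Suc n)
  from Suc.prems(1) obtain w where w: "(low (Suc i) ^^ n) u w" "low (Suc i) w v"
    by (auto elim: relpowp_Suc_E)
  show ?case
  proof (cases "(low i ^^ n) u w")
    case True
    then have "\<not> low i w v"
      using Suc.prems(2) by (auto intro: relpowp_Suc_I)
    then obtain p q where pq: "odd p" "w = p * half i" "odd q" "v = q * half i"
      using low_Suc_cases w(2) by metis
    have "(low (Suc i) ^^ Suc 0) w v"
      using w(2) by (rule relpowp_Suc_I[rotated]) simp
    moreover have "(low i ^^ 0) v v" by simp
    ultimately show ?thesis
      using True pq by (metis add.right_neutral add_Suc_right)
  next
    case False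
    then obtain a b c p q where *: "n = a + b + c" "odd p" "odd q" "(low i ^^ a) u (p * half i)"
      "(low (Suc i) ^^ b) (p * half i) (q * half i)" "(low i ^^ c) (q * half i) w"
      using Suc.IH w(1) by blast
    show ?thesis
    proof (cases "low i w v")
      case True
      then have "(low i ^^ Suc c) (q * half i) v"
        using *(6) by (auto intro: relpowp_Suc_I)
      then show ?thesis using * by (metis add_Suc_right)
    next
      case False
      then obtain q' where q': "odd q'" "v = q' * half i"
        using low_Suc_cases w(2) by metis
      have "(low (Suc i) ^^ c) (q * half i) w"
        using *(6) by (rule low_pow_mono) simp
      then have "(low (Suc i) ^^ Suc (b + c)) (p * half i) v"
        using *(5) w(2) by (metis relpowp_Suc_I relpowp_trans)
      moreover have "(low i ^^ 0) v v" by simp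
      ultimately show ?thesis
        using q' *(1,2,4)
        by (intro exI[of _ a] exI[of _ "Suc (b + c)"] exI[of _ 0] exI[of _ p] exI[of _ q']) simp
    qed
  qed
qed simp

text \<open>
  The term \<open>\<bar>c\<bar>\<close> makes the induction work: an outer piece that ends \<open>2 * half i\<close> further out saves
  only one edge in the middle piece, and it costs at least one more step.
\<close>

lemma low_pow_half_ge:
  "(low i ^^ n) 0 (c * half i) \<Longrightarrow> c \<noteq> 0 \<Longrightarrow> 2 * rad i + \<bar>c\<bar> \<le> 2 * int n + 1"
proof (induction i arbitrary: n c)
  case 0
  then show ?case using low_pow_le[OF 0(1)] by simp
next
  case (Suc i)
  define h where "h = half i"
  have h: "1 \<le> h" "half (Suc i) = 2 * h * h"
    using half_ge_1 by (simp_all add: h_def half_Suc power2_eq_square)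
  have c: "1 \<le> \<bar>c\<bar>" using Suc.prems(2) by simp
  have abs_target: "\<bar>c * half (Suc i)\<bar> = 2 * h * h * \<bar>c\<bar>"
    using h by (simp add: abs_mult)
  \<comment> \<open>Expands \<open>(\<bar>c\<bar> - 1) * (h - 1) \<ge> 0\<close>.\<close>
  have ch: "\<bar>c\<bar> + h \<le> \<bar>c\<bar> * h + 1"
    using mult_nonneg_nonneg[of "\<bar>c\<bar> - 1" "h - 1"] c h by (simp add: algebra_simps)
  show ?case
  proof (cases "(low i ^^ n) 0 (c * half (Suc i))")
    \<comment> \<open>Without edges of layer \<open>2^i\<close> the steps are so short that the walk
      must be long.\<close>
    case True
    have target_nz: "c * half (Suc i) \<noteq> 0"
      using Suc.prems(2) half_pos[of "Suc i"] by (metis less_irrefl mult_eq_0_iff)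
    note bound = low_pow_0_le[OF True target_nz, unfolded abs_target]
    consider "i = 0" | "i = 1" | "2 \<le> i" by linarith
    then show ?thesis
    proof cases
      case 1
      then show ?thesis using bound c by (simp add: h_def)
    next
      case 2
      then have "h = 2" by (simp add: h_def half_def)
      \<comment> \<open>For \<open>\<bar>c\<bar> = 1\<close> the bound reads
        \<open>8 \<le> 2 * n - 1\<close>; integrality gives \<open>n \<ge> 5\<close>, exactly what
        is needed.\<close>
      then show ?thesis using bound c 2 by (simp add: half_def)
    next
      case 3
      have "2 * h * h * \<bar>c\<bar> \<le> int n * max_step i"
        using low_pow_le[OF True] abs_target by simp
      then have "2 * (2 * h * h * \<bar>c\<bar>) \<le> int n * (2 * max_step i)"
        by simp
      also have "\<dots> \<le> int n * h"
        using double_max_step_le_half[OF 3] by (intro mult_left_mono) (auto simp: h_def)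
      finally have "h * (4 * h * \<bar>c\<bar>) \<le> h * int n"
        by (simp add: algebra_simps)
      then have "4 * (\<bar>c\<bar> * h) \<le> int n"
        using h(1) by (simp add: algebra_simps)
      moreover have "rad (Suc i) \<le> 3 * h"
        using rad_le_half[of i] by (simp add: h_def)
      ultimately show ?thesis using c ch h(1) by linarith
    qed
  next
    case False
    then obtain a b d p q where *: "n = a + b + d" "odd p" "odd q" "(low i ^^ a) 0 (p * h)"
      "(low (Suc i) ^^ b) (p * h) (q * h)" "(low i ^^ d) (q * h) (c * half (Suc i))"
      using low_pow_Suc_decompose[OF Suc.prems(1)] unfolding h_def by blast
    have a: "2 * rad i + \<bar>p\<bar> \<le> 2 * int a + 1"
      using Suc.IH[of a p] * by (auto simp: h_def)
    have "\<bar>q * h - p * h\<bar> \<le> int b * (2 * h)"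
      using low_pow_le[OF *(5)] by (simp add: h_def)
    moreover have "q * h - p * h = h * (q - p)"
      by (simp add: algebra_simps)
    ultimately have "h * \<bar>q - p\<bar> \<le> h * (2 * int b)"
      using h(1) by (simp add: abs_mult mult.left_commute)
    then have b: "\<bar>q - p\<bar> \<le> 2 * int b"
      using h(1) by simp
    \<comment> \<open>The last piece is reversed and shifted to start at \<open>0\<close>; its end
      is then a nonzero multiple of \<open>half i\<close> because \<open>q\<close> is odd.\<close>
    have "(low i ^^ d) (c * half (Suc i) + - (c * half (Suc i))) (q * h + - (c * half (Suc i)))"
      by (rule low_pow_translate[OF _ low_pow_sym[OF *(6)]]) (simp add: half_dvd_mono)
    then have "(low i ^^ d) 0 ((q - 2 * h * c) * half i)"
      unfolding h by (simp add: h_def algebra_simps)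
    moreover have "q - 2 * h * c \<noteq> 0"
      using *(3) by (metis dvd_triv_left eq_iff_diff_eq_0 mult.assoc)
    ultimately have d: "2 * rad i + \<bar>q - 2 * h * c\<bar> \<le> 2 * int d + 1"
      by (rule Suc.IH)
    have "\<bar>2 * h * c\<bar> = 2 * (\<bar>c\<bar> * h)"
      using h(1) by (simp add: abs_mult)
    \<comment> \<open>Triangle inequality along \<open>0\<close>, \<open>p\<close>,
      \<open>q\<close>, \<open>2 * h * c\<close>.\<close>
    then have "2 * (\<bar>c\<bar> * h) \<le> 2 * int n + 2 - 4 * rad i"
      using a b d *(1) by linarith
    \<comment> \<open>By \<open>ch\<close> the left side is at most
      \<open>2 * n + 2 - \<bar>c\<bar>\<close>, and \<open>\<bar>c\<bar> \<ge> 1\<close>.\<close>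
    then show ?thesis using ch h(1) c by (simp add: h_def)
  qed
qed

section \<open>Explicit short walks\<close>

lemma reach_refl: "0 \<le> r \<Longrightarrow> reach i r u u"
  unfolding reach_def by (intro exI[of _ 0]) simp

lemma reach_trans: "reach i r u v \<Longrightarrow> reach i s v w \<Longrightarrow> reach i (r + s) u w"
  unfolding reach_def by (metis add_mono of_nat_add relpowp_trans)

lemma reach_mono: "reach i r u v \<Longrightarrow> i \<le> k \<Longrightarrow> r \<le> s \<Longrightarrow> reach k s u v"
  unfolding reach_def by (meson low_pow_mono order_trans)

lemma reach_sym: "reach i r u v \<Longrightarrow> reach i r v u"
  unfolding reach_def by (meson low_pow_sym)

lemma reach_translate: "half i dvd t \<Longrightarrow> reach i r u v \<Longrightarrow> reach i r (u + t) (v + t)"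
  unfolding reach_def by (meson low_pow_translate)

lemma reach_uminus: "reach i r u v \<Longrightarrow> reach i r (- u) (- v)"
  unfolding reach_def by (meson low_pow_uminus)

lemma reach_low: "low i u v \<Longrightarrow> reach i 1 u v"
  unfolding reach_def by (intro exI[of _ 1]) (simp add: eq_OO)

lemma reach_units: "reach i (int n) u (u + int n)"
proof (induction n)
  case (Suc n)
  have "reach i 1 (u + int n) (u + int (Suc n))"
    by (rule reach_low) (simp add: low_def)
  then show ?case using reach_trans[OF Suc] by (simp add: add.commute)
qed (simp add: reach_refl)

lemma reach_diff: "reach i \<bar>v - u\<bar> u v"
proof (cases "u \<le> v")
  case True
  then show ?thesis using reach_units[of i "nat (v - u)" u] by simp
next
  case False
  then show ?thesis using reach_sym[OF reach_units[of i "nat (u - v)" v]] by simp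
qed

lemma reach_jumps: "reach (Suc i) (int n) ((2 * k + 1) * half i) ((2 * (k + int n) + 1) * half i)"
proof (induction n)
  case (Suc n)
  have "reach (Suc i) 1 ((2 * (k + int n) + 1) * half i) ((2 * (k + int (Suc n)) + 1) * half i)"
  proof (rule reach_low)
    have "odd (2 * (k + int n) + 1)" by simp
    moreover have "\<bar>(2 * (k + int (Suc n)) + 1) * half i - (2 * (k + int n) + 1) * half i\<bar> = 2 * half i"
      by (simp add: distrib_right)
    ultimately show "low (Suc i) ((2 * (k + int n) + 1) * half i) ((2 * (k + int (Suc n)) + 1) * half i)"
      unfolding low_def by blast
  qed
  then show ?case using reach_trans[OF Suc] by (simp add: add.commute)
qed (simp add: reach_refl)

lemma reach_jumps_diff: "reach (Suc i) \<bar>l - k\<bar> ((2 * k + 1) * half i) ((2 * l + 1) * half i)"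
proof (cases "k \<le> l")
  case True
  then show ?thesis using reach_jumps[of i "nat (l - k)" k] by simp
next
  case False
  then show ?thesis using reach_sym[OF reach_jumps[of i "nat (k - l)" l]] by simp
qed

text \<open>Block \<open>k\<close> is the block from \<open>0\<close> to \<open>2 * half i\<close>
  shifted by a multiple of \<open>half i\<close>. The claim for that block is an assumption so that
  the lemma can serve inside the induction of \<open>reach_half\<close>.\<close>

lemma reach_block_centre:
  assumes "\<And>w. 0 \<le> w \<Longrightarrow> w \<le> 2 * half i \<Longrightarrow> reach i (rad i) w (half i)"
    and "2 * half i * k \<le> v" "v \<le> 2 * half i * (k + 1)"
  shows "reach (Suc i) (rad i) v ((2 * k + 1) * half i)"
proof -
  have "reach i (rad i) (v - 2 * half i * k) (half i)"
    using assms(2,3) by (intro assms(1)) (auto simp: algebra_simps)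
  from reach_translate[OF _ this, of "2 * half i * k"]
  have "reach i (rad i) v ((2 * k + 1) * half i)"
    by (simp add: algebra_simps)
  then show ?thesis by (rule reach_mono) auto
qed

lemma ex_block:
  fixes v d b :: int
  assumes "0 \<le> v" "v < d * b" "0 < d"
  shows "\<exists>k\<ge>0. k < b \<and> d * k \<le> v \<and> v \<le> d * (k + 1)"
\<comment> \<open>The witness is \<open>v div d\<close>.\<close>
proof (intro exI conjI)
  have "0 \<le> v mod d" "v mod d < d" "d * (v div d) + v mod d = v"
    using assms(3) by simp_all
  then show block: "d * (v div d) \<le> v" "v \<le> d * (v div d + 1)"
    unfolding distrib_left by linarith+
  show "0 \<le> v div d"
    using assms by (simp add: pos_imp_zdiv_nonneg_iff)
  have "d * (v div d) < d * b"
    using block(1) assms(2) by linarith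
  then show "v div d < b"
    using assms(3) by (simp add: mult_less_cancel_left)
qed

text \<open>Walk from \<open>v\<close> to the centre of its block of length \<open>2 * h\<close>,
  jump along centres, and descend to the target. The target is the common end of blocks
  \<open>h - 1\<close> and \<open>h\<close>; choosing the one on the side of \<open>v\<close> keeps
  the jumps to at most \<open>h - 1\<close>.\<close>

lemma reach_half: "0 \<le> v \<Longrightarrow> v \<le> 2 * half i \<Longrightarrow> reach i (rad i) v (half i)"
proof (induction i arbitrary: v)
  case 0
  then show ?case
    using reach_mono[OF reach_diff[of 0 1 v], of 0 1] by simp
next
  case (Suc i)
  define h where "h = half i"
  have h: "1 \<le> h" "half (Suc i) = 2 * h * h"
    using half_ge_1 by (simp_all add: h_def half_Suc power2_eq_square)
  note centre = reach_block_centre[OF Suc.IH, folded h_def]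
  have *: "reach (Suc i) (rad (Suc i)) v (half (Suc i))"
    if "2 * h * k \<le> v" "v \<le> 2 * h * (k + 1)" "2 * h * l \<le> half (Suc i)"
      "half (Suc i) \<le> 2 * h * (l + 1)" "\<bar>l - k\<bar> \<le> h - 1" for k l
  proof -
    have "reach (Suc i) (rad i + \<bar>l - k\<bar> + rad i) v (half (Suc i))"
      using centre[OF _ _ that(1,2)] reach_jumps_diff[of i l k, folded h_def]
        reach_sym[OF centre[OF _ _ that(3,4)]]
      by (meson reach_trans)
    then show ?thesis
      using that(5) by (elim reach_mono) (auto simp: h_def)
  qed
  show ?case
  proof (cases "v = 2 * half (Suc i)")
    \<comment> \<open>The right end of the last block escapes the strict bound in
      \<open>ex_block\<close>.\<close>
    case True
    show ?thesis
      by (rule *[of "2 * h - 1" h]) (use True h in \<open>auto simp: algebra_simps\<close>)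
  next
    case False
    obtain k where k: "0 \<le> k" "k < 2 * h" "2 * h * k \<le> v" "v \<le> 2 * h * (k + 1)"
      using ex_block[of v "2 * h" "2 * h"] Suc.prems False h by (auto simp: algebra_simps)
    show ?thesis
    proof (cases "k < h")
      case True
      show ?thesis
        by (rule *[of k "h - 1"]) (use k True h in \<open>auto simp: algebra_simps\<close>)
    next
      case False
      show ?thesis
        by (rule *[of k h]) (use k False h in \<open>auto simp: algebra_simps\<close>)
    qed
  qed
qed

lemma reach_0_centre: "0 \<le> k \<Longrightarrow> reach (Suc i) (rad i + k) 0 ((2 * k + 1) * half i)"
  using reach_trans[OF reach_mono[OF reach_half[of 0 i], of "Suc i" "rad i"], of k]
    reach_jumps_diff[of i k 0]
  by simp

text \<open>The same route, started in block \<open>0\<close>: the interval from \<open>0\<close> to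
  \<open>half i\<close> consists of \<open>h\<close> blocks, so \<open>h - 1\<close> jumps suffice.
  Reflection covers negative \<open>v\<close>.\<close>

lemma reach_0_half:
  assumes "\<bar>v\<bar> \<le> half i"
  shows "reach i (rad i) 0 v"
proof -
  have "reach i (rad i) 0 v" if v: "0 \<le> v" "v \<le> half i" for v
  proof (cases i)
    case 0
    then show ?thesis
      using reach_mono[OF reach_diff[of 0 v 0], of 0 1] v by simp
  next
    case (Suc m)
    define h where "h = half m"
    have h: "1 \<le> h" "half i = 2 * h * h"
      using half_ge_1 by (simp_all add: h_def Suc half_Suc power2_eq_square)
    have *: "reach i (rad i) 0 v" if "0 \<le> k" "k \<le> h - 1" "2 * h * k \<le> v" "v \<le> 2 * h * (k + 1)" for k
    proof -
      have "reach i (rad m + k + rad m) 0 v"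
        using reach_trans[OF reach_0_centre[OF that(1), of m]]
          reach_sym[OF reach_block_centre[OF reach_half that(3,4)[unfolded h_def]]] Suc by blast
      then show ?thesis
        using that(2) by (elim reach_mono) (auto simp: h_def Suc)
    qed
    show ?thesis
    proof (cases "v = half i")
      case True
      show ?thesis
        by (rule *[of "h - 1"]) (use True h in \<open>auto simp: algebra_simps\<close>)
    next
      case False
      obtain k where "0 \<le> k" "k < h" "2 * h * k \<le> v" "v \<le> 2 * h * (k + 1)"
        using ex_block[of v "2 * h" h] v False h by auto
      show ?thesis
        by (rule *[of k]) (simp_all add: \<open>0 \<le> k\<close> \<open>k < h\<close> \<open>2 * h * k \<le> v\<close> \<open>v \<le> 2 * h * (k + 1)\<close>)
    qed
  qed
  from this[of v] this[of "- v"] assms reach_uminus[of i "rad i" 0 "- v"]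
  show ?thesis by (cases "0 \<le> v") auto
qed

section \<open>Edges, walks and graph distance\<close>

lemma mem_layer_two_power:
  "(u, v) \<in> layer (2 ^ k) \<longleftrightarrow> (\<exists>n. odd n \<and> u = n * half k \<and> v = u + 2 * half k)"
proof -
  obtain p where p: "(2::nat) ^ k = Suc p"
    by (metis not0_implies_Suc power_not_zero zero_neq_numeral)
  then have e: "(2::int) ^ 2 ^ k = 2 * half k" "(2::int) ^ (2 ^ k - 1) = half k"
    by (simp_all add: half_def)
  have "(u, v) \<in> layer (2 ^ k) \<longleftrightarrow> (\<exists>m. u = 2 * half k * m - half k \<and> v = 2 * half k * m + half k)"
    unfolding layer_def e by simp
  also have "\<dots> \<longleftrightarrow> (\<exists>m. u = (2 * m - 1) * half k \<and> v = u + 2 * half k)"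
    by (intro arg_cong[where f = Ex] ext) (auto simp: algebra_simps)
  \<comment> \<open>The index \<open>m\<close> belongs to the midpoint of the edge,
    \<open>n = 2 * m - 1\<close> to its left end.\<close>
  also have "\<dots> \<longleftrightarrow> (\<exists>n. odd n \<and> u = n * half k \<and> v = u + 2 * half k)"
    (is "(\<exists>m. ?P m) \<longleftrightarrow> (\<exists>n. ?Q n)")
  proof
    assume "\<exists>m. ?P m"
    then obtain m where "?P m" by blast
    then have "?Q (2 * m - 1)" by simp
    then show "\<exists>n. ?Q n" by blast
  next
    assume "\<exists>n. ?Q n"
    then obtain n where "?Q n" by blast
    moreover then obtain t where "n = 2 * t + 1" by (blast elim: oddE)
    ultimately have "?P (t + 1)" by simp
    then show "\<exists>m. ?P m" by blast
  qed
  finally show ?thesis .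
qed

lemma parcs_G_tilde_iff: "(u, v) \<in> parcs G_tilde \<longleftrightarrow> (\<exists>i. low i u v)"
proof -
  define E where "E = layer 0 \<union> (\<Union>k. layer (2 ^ k))"
  have arcs: "(u, v) \<in> parcs G_tilde \<longleftrightarrow> (u, v) \<in> E \<or> (v, u) \<in> E"
    by (simp add: G_tilde_def Let_def E_def)
  have E_low: "\<exists>i. low i u v" if "(u, v) \<in> E" for u v
  proof -
    from that consider "v = u + 1" | k where "(u, v) \<in> layer (2 ^ k)"
      by (auto simp: E_def layer_def)
    then show ?thesis
    proof cases
      case 1
      then show ?thesis by (auto simp: low_def)
    next
      case 2
      then obtain n where "odd n" "u = n * half k" "v = u + 2 * half k"
        unfolding mem_layer_two_power by blast
      then have "low (Suc k) u v"
        unfolding low_def by (intro disjI2 exI[of _ k]) auto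
      then show ?thesis by blast
    qed
  qed
  have low_E: "(u, v) \<in> E" if "low i u v" "u < v" for i u v
    using that(1) unfolding low_def
  proof (elim disjE exE conjE)
    assume "\<bar>v - u\<bar> = 1"
    then show ?thesis using that(2) by (auto simp: E_def layer_def)
  next
    fix k n assume "odd n" "u = n * half k" "\<bar>v - u\<bar> = 2 * half k"
    then have "(u, v) \<in> layer (2 ^ k)"
      unfolding mem_layer_two_power using that(2) by (intro exI[of _ n]) auto
    then show ?thesis by (auto simp: E_def)
  qed
  have neq: "u \<noteq> v" if "low i u v" for i
    using that by (auto simp: low_def)
  show ?thesis
    unfolding arcs using E_low low_E low_sym neq by (metis linorder_neqE)
qed

lemma awalk_imp_relpowp:
  "G_tilde.awalk u p v \<Longrightarrow> ((\<lambda>u v. (u, v) \<in> parcs G_tilde) ^^ length p) u v"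
proof (induction p arbitrary: u)
  case Nil
  then show ?case by (simp add: G_tilde.awalk_Nil_iff)
next
  case (Cons e p)
  then show ?case
    by (cases e) (auto simp: G_tilde.awalk_Cons_iff simp del: relpowp.simps intro!: relpowp_Suc_I2)
qed

lemma relpowp_imp_awalk:
  "((\<lambda>u v. (u, v) \<in> parcs G_tilde) ^^ n) u v \<Longrightarrow> \<exists>p. length p = n \<and> G_tilde.awalk u p v"
proof (induction n arbitrary: u)
  case 0
  then show ?case by (simp add: G_tilde.awalk_Nil_iff)
next
  case (Suc n)
  then obtain w where w: "(u, w) \<in> parcs G_tilde" "((\<lambda>u v. (u, v) \<in> parcs G_tilde) ^^ n) w v"
    using relpowp_Suc_D2[OF Suc.prems] by auto
  then obtain p where "length p = n" "G_tilde.awalk w p v"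
    using Suc.IH by blast
  then show ?case
    using w(1) by (intro exI[of _ "(u, w) # p"]) (auto simp: G_tilde.awalk_Cons_iff)
qed

lemma graph_dist_le_iff:
  "graph_dist G_tilde u v \<le> ereal (real r) \<longleftrightarrow>
    (\<exists>n\<le>r. ((\<lambda>u v. (u, v) \<in> parcs G_tilde) ^^ n) u v)"
proof -
  let ?P = "{p. G_tilde.awalk u p v}"
  have cost: "G_tilde.awalk_cost (\<lambda>_. 1) q = real (length q)" for q
    by (induction q) simp_all
  have dist: "graph_dist G_tilde u v = (INF q\<in>?P. ereal (real (length q)))"
    by (simp add: graph_dist_def G_tilde.\<mu>_def cost)
  show ?thesis
  proof
    assume le: "graph_dist G_tilde u v \<le> ereal (real r)"
    \<comment> \<open>An infimum strictly below \<open>r + 1\<close> yields a walk of length at most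
      \<open>r\<close>, without an appeal to attainment.\<close>
    have "\<exists>q\<in>?P. ereal (real (length q)) < ereal (real (Suc r))"
    proof -
      have "graph_dist G_tilde u v < ereal (real (Suc r))"
        using le by (rule le_less_trans) simp
      then show ?thesis unfolding dist by (simp add: INF_less_iff)
    qed
    then obtain q where "G_tilde.awalk u q v" "length q \<le> r" by auto
    then show "\<exists>n\<le>r. ((\<lambda>u v. (u, v) \<in> parcs G_tilde) ^^ n) u v"
      using awalk_imp_relpowp by blast
  next
    assume "\<exists>n\<le>r. ((\<lambda>u v. (u, v) \<in> parcs G_tilde) ^^ n) u v"
    then obtain p where "length p \<le> r" "p \<in> ?P"
      using relpowp_imp_awalk by blast
    then have "graph_dist G_tilde u v \<le> ereal (real (length p))" "length p \<le> r"
      unfolding dist by (auto intro: INF_lower)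
    then show "graph_dist G_tilde u v \<le> ereal (real r)"
      by (elim order_trans) simp
  qed
qed

text \<open>The first edge outside \<open>low i\<close> would start at a nonzero multiple of
  \<open>half i\<close>, and \<open>low_pow_half_ge\<close> makes reaching that point cost
  \<open>rad i\<close> steps already.\<close>

lemma relpowp_imp_low_pow:
  assumes "((\<lambda>u v. (u, v) \<in> parcs G_tilde) ^^ n) 0 v" "int n \<le> rad i"
  shows "(low i ^^ n) 0 v"
  using assms
proof (induction n arbitrary: v)
  case (Suc n)
  then obtain w where w: "((\<lambda>u v. (u, v) \<in> parcs G_tilde) ^^ n) 0 w" "(w, v) \<in> parcs G_tilde"
    by (auto elim: relpowp_Suc_E)
  then have n: "(low i ^^ n) 0 w"
    using Suc by simp
  have "low i w v"
  proof (rule ccontr)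
    assume "\<not> low i w v"
    moreover obtain l where "low l w v"
      using w(2) parcs_G_tilde_iff by blast
    ultimately obtain k m where k: "i \<le> k" "odd m" "w = m * half k"
      unfolding low_def using not_le by blast
    then obtain s where s: "half k = half i * s"
      using half_dvd_mono by blast
    have "w = (m * s) * half i" using k s by simp
    moreover have "m * s \<noteq> 0"
      using k(2) s half_pos[of k] by (metis even_zero less_irrefl mult_eq_0_iff)
    ultimately have "rad i \<le> int n"
      using low_pow_half_ge[where i = i and n = n and c = "m * s"] n by auto
    then show False using Suc.prems(2) by simp
  qed
  then show ?case using n by (auto intro: relpowp_Suc_I)
qed simp

lemma reach_imp_dist_le: "reach i (int r) u v \<Longrightarrow> graph_dist G_tilde u v \<le> ereal (real r)"
proof -
  assume "reach i (int r) u v"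
  then obtain n where "n \<le> r" "(low i ^^ n) u v"
    by (auto simp: reach_def)
  moreover from this(2) have "((\<lambda>u v. (u, v) \<in> parcs G_tilde) ^^ n) u v"
    by (rule relpowp_mono[rotated]) (auto simp: parcs_G_tilde_iff)
  ultimately show ?thesis unfolding graph_dist_le_iff by blast
qed

lemma dist_le_imp_low_pow:
  assumes "graph_dist G_tilde 0 v \<le> ereal (real r)" "int r \<le> rad i"
  shows "\<exists>n\<le>r. (low i ^^ n) 0 v"
proof -
  obtain n where n: "n \<le> r" "((\<lambda>u v. (u, v) \<in> parcs G_tilde) ^^ n) 0 v"
    using assms(1) unfolding graph_dist_le_iff by blast
  then have "(low i ^^ n) 0 v"
    using assms(2) by (intro relpowp_imp_low_pow) simp_all
  then show ?thesis using n(1) by blast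
qed

lemma x_tilde_two_power: "x_tilde (2 ^ i) = ereal (real (nat (rad i)))"
proof (rule antisym)
  have target: "x_tilde (2 ^ i) = graph_dist G_tilde 0 (half i)"
    by (simp add: x_tilde_def half_def)
  have r: "int (nat (rad i)) = rad i"
    using rad_pos[of i] by simp
  show upper: "x_tilde (2 ^ i) \<le> ereal (real (nat (rad i)))"
    unfolding target by (rule reach_imp_dist_le[of i], unfold r) (simp add: reach_0_half)
  obtain j where j: "x_tilde (2 ^ i) = ereal (real j)"
    unfolding target using graph_dist_G_tilde_nat by blast
  \<comment> \<open>The upper bound confines a shortest walk to \<open>low i\<close>, where the
    lower bound applies.\<close>
  then have "int j \<le> rad i"
    using upper r by (metis ereal_less_eq(3) of_nat_le_iff)
  then obtain n where n: "n \<le> j" "(low i ^^ n) 0 (half i)"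
    using dist_le_imp_low_pow[of "half i" j i] j target by auto
  then have "rad i \<le> int n"
    using low_pow_half_ge[where i = i and n = n and c = 1] by simp
  then show "ereal (real (nat (rad i))) \<le> x_tilde (2 ^ i)"
    using n(1) j by simp
qed

section \<open>Size of the ball\<close>

lemma graph_ball_subset:
  assumes "int j = rad i"
  shows "graph_ball G_tilde 0 j \<subseteq> {- (int j * max_step i)..int j * max_step i}"
proof
  fix v assume "v \<in> graph_ball G_tilde 0 j"
  then have "graph_dist G_tilde 0 v \<le> ereal (real j)"
    by (simp add: graph_ball_def)
  then obtain n where n: "n \<le> j" "(low i ^^ n) 0 v"
    using dist_le_imp_low_pow[of v j i, OF _ eq_refl[OF assms]] by blast
  have "\<bar>v\<bar> \<le> int n * max_step i"
    using low_pow_le[OF n(2)] by simp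
  also have "\<dots> \<le> int j * max_step i"
    using n(1) max_step_pos[of i] by (intro mult_right_mono) auto
  finally show "v \<in> {- (int j * max_step i)..int j * max_step i}" by auto
qed

lemma mem_graph_ball: "reach i (int j) 0 v \<Longrightarrow> v \<in> graph_ball G_tilde 0 j"
  by (simp add: graph_ball_def reach_imp_dist_le)

lemma interval_subset_graph_ball:
  assumes "int j = rad i"
  shows "{- half i..half i} \<subseteq> graph_ball G_tilde 0 j"
proof
  fix v assume "v \<in> {- half i..half i}"
  then have "\<bar>v\<bar> \<le> half i" by auto
  then show "v \<in> graph_ball G_tilde 0 j"
    using mem_graph_ball reach_0_half assms by metis
qed

text \<open>After \<open>rad i + k\<close> steps to a block centre, \<open>\<bar>w\<bar>\<close>
  unit steps remain. This supplies the vertices beyond the interval in the two exceptional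
  cases.\<close>

lemma near_centre_mem_graph_ball:
  assumes "0 \<le> k" "rad i + k + \<bar>w\<bar> \<le> int j"
  shows "(2 * k + 1) * half i + w \<in> graph_ball G_tilde 0 j"
    and "- ((2 * k + 1) * half i + w) \<in> graph_ball G_tilde 0 j"
proof -
  have "reach (Suc i) (int j) 0 ((2 * k + 1) * half i + w)"
  proof (rule reach_mono[OF reach_trans[OF reach_0_centre[OF assms(1)]]])
    show "reach (Suc i) \<bar>w\<bar> ((2 * k + 1) * half i) ((2 * k + 1) * half i + w)"
      using reach_diff[of "Suc i" "(2 * k + 1) * half i + w" "(2 * k + 1) * half i"]
      by (simp only: add_diff_cancel_left')
  qed (use assms(2) in simp_all)
  with reach_uminus[OF this] show "(2 * k + 1) * half i + w \<in> graph_ball G_tilde 0 j"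
    and "- ((2 * k + 1) * half i + w) \<in> graph_ball G_tilde 0 j"
    by (simp_all only: mem_graph_ball minus_zero)
qed

text \<open>At \<open>i = 2\<close> this fails, \<open>10\<close> against \<open>9\<close>, which is
  why the general lower bound starts one index higher, at \<open>4\<close>.\<close>

lemma double_rad_le_half: "3 \<le> i \<Longrightarrow> 2 * rad i \<le> half i + 1"
proof (induction i rule: dec_induct)
  case base
  then show ?case by (simp add: half_def numeral_3_eq_3)
next
  case (step k)
  have "2 * rad (Suc k) \<le> 2 * (2 * half k)"
    using step(3) by simp
  also have "\<dots> \<le> 2 * (half k * half k)"
    using half_ge_8[of k] step(1) by (intro mult_left_mono mult_right_mono) auto
  also have "\<dots> \<le> half (Suc k) + 1"
    by (simp add: half_Suc power2_eq_square)
  finally show ?case .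
qed

lemma card_ge_of_symmetric:
  fixes B E :: "int set" and h :: int
  assumes "finite B" "{- h..h} \<subseteq> B" "0 \<le> h" "E \<subseteq> {h<..}"
    and mem: "\<And>x. x \<in> E \<Longrightarrow> x \<in> B \<and> - x \<in> B"
  shows "2 * h + 1 + 2 * int (card E) \<le> int (card B)"
proof -
  have fin: "finite E"
    using assms(1) mem by (meson finite_subset subsetI)
  have "card ({- h..h} \<union> E \<union> uminus ` E) = card {- h..h} + card E + card (uminus ` E)"
  proof -
    have gt: "h < x" if "x \<in> E" for x
      using assms(4) that by auto
    have "({- h..h} \<union> E) \<inter> uminus ` E = {}"
      using assms(3) by (auto dest!: gt)
    moreover have "{- h..h} \<inter> E = {}"
      by (auto dest: gt)
    ultimately show ?thesis
      using fin by (simp add: card_Un_disjoint)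
  qed
  moreover have "card (uminus ` E) = card E"
    by (rule card_image) simp
  moreover have "card ({- h..h} \<union> E \<union> uminus ` E) \<le> card B"
    using assms(1,2) mem by (intro card_mono) auto
  ultimately show ?thesis using assms(3) by simp
qed

theorem lemma6:
  fixes i j :: nat
  assumes "ereal (real j) = x_tilde (2 ^ i)"
  shows "j ^ 2 \<le> card (graph_ball G_tilde 0 j)
    \<and> card (graph_ball G_tilde 0 j) \<le> 8 * j ^ 2"
proof
  let ?B = "graph_ball G_tilde 0 j"
  have j: "int j = rad i"
    using assms rad_pos[of i] by (simp add: x_tilde_two_power)
  have j1: "1 \<le> int j" using j rad_pos by simp
  note sub = graph_ball_subset[OF j]
  have fin: "finite ?B" using sub by (rule finite_subset) simp
  have "int (card ?B) \<le> int (card {- (int j * max_step i)..int j * max_step i})"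
    using card_mono[OF finite_atLeastAtMost_int sub] by (simp only: of_nat_le_iff)
  also have "\<dots> = 2 * (int j * max_step i) + 1"
    using mult_nonneg_nonneg[of "int j" "max_step i"] max_step_pos[of i] by simp
  also have "\<dots> \<le> 2 * (int j * (2 * int j)) + 1"
    using max_step_le_rad[of i] j by (intro add_mono mult_left_mono) auto
  \<comment> \<open>The left side is \<open>4 * j^2 + 1\<close>, and
    \<open>j \<ge> 1\<close>.\<close>
  also have "\<dots> \<le> 8 * (int j)\<^sup>2"
    using one_le_power[OF j1, of 2] by (simp add: power2_eq_square)
  finally show "card ?B \<le> 8 * j ^ 2"
    by (metis of_nat_le_iff of_nat_mult of_nat_numeral of_nat_power)
  have interval: "2 * half i + 1 \<le> int (card ?B)"
    using card_mono[OF fin interval_subset_graph_ball[OF j]] half_pos[of i] by simp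
  \<comment> \<open>For \<open>i\<close> from \<open>0\<close> to \<open>3\<close> the interval has
    3, 5, 17, 257 vertices, against 1, 4, 25, 289 for \<open>j^2\<close>.\<close>
  consider "i = 0" | "i = 1" | "i = 2" | "i = 3" | "4 \<le> i"
    by linarith
  then show "j ^ 2 \<le> card ?B"
  proof cases
    case 1
    then show ?thesis using interval j by simp
  next
    case 2
    then show ?thesis using interval j by (simp add: half_def)
  next
    case 3
    then have "j = 5" using j by (simp add: half_def numeral_2_eq_2)
    \<comment> \<open>Points around the centres 10 and 14; with their negatives the count is
      \<open>17 + 8 = 25\<close>, exactly \<open>j^2\<close>.\<close>
    let ?E = "{9, 10, 11, 14} :: int set"
    have "x \<in> ?B \<and> - x \<in> ?B" if "x \<in> ?E" for x
      using that near_centre_mem_graph_ball[of 2 1 "x - 10" j] near_centre_mem_graph_ball[of 3 1 "x - 14" j]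
      by (auto simp: \<open>j = 5\<close> half_def)
    then have "2 * half i + 1 + 2 * int (card ?E) \<le> int (card ?B)"
      using 3 by (intro card_ge_of_symmetric[OF fin interval_subset_graph_ball[OF j]]) (auto simp: half_def)
    then show ?thesis using \<open>j = 5\<close> 3 by (simp add: half_def)
  next
    case 4
    then have "j = 17" using j by (simp add: half_def numeral_3_eq_3)
    \<comment> \<open>Points around the centres 136, 152, 168, 184; the count is
      \<open>257 + 32 = 289\<close>, again exactly \<open>j^2\<close>.\<close>
    let ?E = "{134, 135, 136, 137, 138, 150, 151, 152, 153, 154, 166, 167, 168, 169, 170, 184} :: int set"
    have "x \<in> ?B \<and> - x \<in> ?B" if "x \<in> ?E" for x
    proof -
      from that consider "\<bar>x - 136\<bar> \<le> 2" | "\<bar>x - 152\<bar> \<le> 2" | "\<bar>x - 168\<bar> \<le> 2" | "x = 184"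
        by auto
      then show ?thesis
      proof cases
        case 1
        then show ?thesis using near_centre_mem_graph_ball[of 8 2 "x - 136" j]
          by (simp add: \<open>j = 17\<close> half_def numeral_2_eq_2)
      next
        case 2
        then show ?thesis using near_centre_mem_graph_ball[of 9 2 "x - 152" j]
          by (simp add: \<open>j = 17\<close> half_def numeral_2_eq_2)
      next
        case 3
        then show ?thesis using near_centre_mem_graph_ball[of 10 2 "x - 168" j]
          by (simp add: \<open>j = 17\<close> half_def numeral_2_eq_2)
      next
        case 4
        then show ?thesis using near_centre_mem_graph_ball[of 11 2 "x - 184" j]
          by (simp add: \<open>j = 17\<close> half_def numeral_2_eq_2)
      qed
    qed
    then have "2 * half i + 1 + 2 * int (card ?E) \<le> int (card ?B)"
      using 4 by (intro card_ge_of_symmetric[OF fin interval_subset_graph_ball[OF j]]) (auto simp: half_def)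
    then show ?thesis using \<open>j = 17\<close> 4 by (simp add: half_def)
  next
    case 5
    then obtain m where m: "i = Suc m" "3 \<le> m"
      by (cases i) auto
    then have "int j \<le> 2 * half m"
      using j double_rad_le_half[of m] by simp
    then have "(int j)\<^sup>2 \<le> (2 * half m)\<^sup>2"
      by (intro power_mono) auto
    \<comment> \<open>Here \<open>(2 * half m)^2 = 2 * half i\<close>.\<close>
    also have "\<dots> \<le> int (card ?B)"
      using interval m(1) by (simp add: half_Suc power_mult_distrib)
    finally show ?thesis by (metis of_nat_le_iff of_nat_power)
  qed
qed

end
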